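(* Let $(\mathbb{M},\mu\colon\mathbb{M}\otimes\mathbb{M}\to\mathbb{M},\eta\colon I\to\mathbb{M})$ be a partial finiteness monoid, with $\mathbb{M}=(M,\mathcal{U})$, and let $R$ be a ring (with unit, not necessarily commutative). Then the abelian group $R\langle\mathbb{M}\rangle$ canonically has the structure of a (unital, not necessarily commutative) ring, namely with multiplication $$(f\cdot g)(m)=\sum_{(m_1,m_2)\in X_m(f,g)} f(m_1)\cdot g(m_2),$$ where $$X_m(f,g)=\{(m_1,m_2)\in M\times M \mid \mu(m_1,m_2)\text{ is defined and equal to } m,\ f(m_1)\neq 0,\ g(m_2)\neq 0\},$$ and with unit the function $e\colon M\to R$ given by $e(m)=1_R$ if $\eta( * )$ is defined and $m=\eta( * )$, and $e(m)=0$ otherwise.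
   Context: For a set $X$ and a collection $\mathcal{U}\subseteq\mathcal{P}(X)$ of subsets, put $\mathcal{U}^\perp=\{u'\subseteq X \mid u'\cap u \text{ is finite for all } u\in\mathcal{U}\}$. A finiteness space is a pair $(X,\mathcal{U})$ with $X$ a set and $\mathcal{U}\subseteq\mathcal{P}(X)$ such that $\mathcal{U}^{\perp\perp}=\mathcal{U}$. The category $\mathsf{FinPf}$ has finiteness spaces as objects. A morphism $f\colon (X,\mathcal{U})\to(Y,\mathcal{V})$ is a partial function $f\colon X\to Y$ such that (1) for all $u\in\mathcal{U}$, the image $f(u)=\{f(x)\mid x\in u,\ f(x)\text{ defined}\}$ is in $\mathcal{V}$; and (2) for all $v'\in\mathcal{V}^\perp$, the preimage $f^{-1}(v')=\{x\in X\mid f(x)\text{ is defined and } f(x)\in v'\}$ is in $\mathcal{U}^\perp$. Composition and identities are those of partial functions. $\mathsf{FinPf}$ is symmetric monoidal with tensor $(X,\mathcal{U})\otimes(Y,\mathcal{V})=(X\times Y,\mathcal{W})$, where $\mathcal{W}=\{u\times v\mid u\in\mathcal{U},v\in\mathcal{V}\}^{\perp\perp}=\{w\mid \exists u\in\mathcal{U},\exists v\in\mathcal{V},\ w\subseteq u\times v\}$; on morphisms, $(f\otimes g)(x,y)=(f(x),g(y))$, defined exactly when both $f(x)$ and $g(y)$ are defined. The unit is $I=(\{*\},\mathcal{P}(\{*\}))$, and the structural isomorphisms are those of the cartesian product of sets. A partial finiteness monoid is an internal monoid in this monoidal category. For an abelian group $A$ and a finiteness space $\mathbb{X}=(X,\mathcal{U})$,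 $A\langle\mathbb{X}\rangle$ is the abelian group $\{f\colon X\to A\mid \mathrm{supp}(f)\in\mathcal{U}\}$ with pointwise addition, where $\mathrm{supp}(f)=\{x\in X\mid f(x)\neq 0\}$. Rings are unital but not necessarily commutative (the zero ring is allowed). *)

theory Defs
  imports "HOL-Algebra.Ring"
begin

record 'a fin_space =
  pts :: "'a set"
  fins :: "'a set set"

definition perp :: "'a set \<Rightarrow> 'a set set \<Rightarrow> 'a set set" where
  "perp X U = {u'. u' \<subseteq> X \<and> (\<forall>u\<in>U. finite (u' \<inter> u))}"

definition finiteness_space :: "'a fin_space \<Rightarrow> bool" where
  "finiteness_space X \<longleftrightarrow>
     fins X \<subseteq> Pow (pts X) \<and> perp (pts X) (perp (pts X) (fins X)) = fins X"

text \<open>Partial functions between the underlying sets are maps whose domain and range lie in these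
  sets. With this convention, equality of partial functions is equality of maps, and composition
  of partial functions is \<open>map_comp\<close>.\<close>

definition finpf_hom :: "'a fin_space \<Rightarrow> 'b fin_space \<Rightarrow> ('a \<rightharpoonup> 'b) set" where
  "finpf_hom X Y = {f. dom f \<subseteq> pts X \<and> ran f \<subseteq> pts Y \<and>
     (\<forall>u \<in> fins X. {y. \<exists>x\<in>u. f x = Some y} \<in> fins Y) \<and>
     (\<forall>v' \<in> perp (pts Y) (fins Y).
        {x \<in> pts X. \<exists>y\<in>v'. f x = Some y} \<in> perp (pts X) (fins X))}"

definition finpf_id :: "'a fin_space \<Rightarrow> ('a \<rightharpoonup> 'a)" where
  "finpf_id X = (\<lambda>x. if x \<in> pts X then Some x else None)"

definition fin_tensor :: "'a fin_space \<Rightarrow> 'b fin_space \<Rightarrow> ('a \<times> 'b) fin_space" where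
  "fin_tensor X Y =
     \<lparr>pts = pts X \<times> pts Y,
      fins = perp (pts X \<times> pts Y)
               (perp (pts X \<times> pts Y) {u \<times> v | u v. u \<in> fins X \<and> v \<in> fins Y})\<rparr>"

definition map_tensor :: "('a \<rightharpoonup> 'c) \<Rightarrow> ('b \<rightharpoonup> 'd) \<Rightarrow> ('a \<times> 'b \<rightharpoonup> 'c \<times> 'd)" where
  "map_tensor f g = (\<lambda>(x, y). case (f x, g y) of
     (Some x', Some y') \<Rightarrow> Some (x', y') | _ \<Rightarrow> None)"

definition fin_unit :: "unit fin_space" where
  "fin_unit = \<lparr>pts = {()}, fins = Pow {()}\<rparr>"

definition finpf_assoc ::
  "'a fin_space \<Rightarrow> 'b fin_space \<Rightarrow> 'c fin_space \<Rightarrow> (('a \<times> 'b) \<times> 'c \<rightharpoonup> 'a \<times> ('b \<times> 'c))" where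
  "finpf_assoc X Y Z = (\<lambda>((x, y), z).
     if x \<in> pts X \<and> y \<in> pts Y \<and> z \<in> pts Z then Some (x, (y, z)) else None)"

definition finpf_lunit :: "'a fin_space \<Rightarrow> (unit \<times> 'a \<rightharpoonup> 'a)" where
  "finpf_lunit X = (\<lambda>(_, x). if x \<in> pts X then Some x else None)"

definition finpf_runit :: "'a fin_space \<Rightarrow> ('a \<times> unit \<rightharpoonup> 'a)" where
  "finpf_runit X = (\<lambda>(x, _). if x \<in> pts X then Some x else None)"

definition partial_finiteness_monoid ::
  "'m fin_space \<Rightarrow> ('m \<times> 'm \<rightharpoonup> 'm) \<Rightarrow> (unit \<rightharpoonup> 'm) \<Rightarrow> bool" where
  "partial_finiteness_monoid M mu eta \<longleftrightarrow>
     finiteness_space M \<and>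
     mu \<in> finpf_hom (fin_tensor M M) M \<and>
     eta \<in> finpf_hom fin_unit M \<and>
     mu \<circ>\<^sub>m map_tensor mu (finpf_id M)
       = (mu \<circ>\<^sub>m map_tensor (finpf_id M) mu) \<circ>\<^sub>m finpf_assoc M M M \<and>
     mu \<circ>\<^sub>m map_tensor eta (finpf_id M) = finpf_lunit M \<and>
     mu \<circ>\<^sub>m map_tensor (finpf_id M) eta = finpf_runit M"

definition supp :: "('r, 's) ring_scheme \<Rightarrow> 'a fin_space \<Rightarrow> ('a \<Rightarrow> 'r) \<Rightarrow> 'a set" where
  "supp A X f = {x \<in> pts X. f x \<noteq> \<zero>\<^bsub>A\<^esub>}"

text \<open>Functions on the underlying set of a finiteness space are represented extensionally, with
  value \<open>undefined\<close> outside it.\<close>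

definition fin_funs :: "('r, 's) ring_scheme \<Rightarrow> 'a fin_space \<Rightarrow> ('a \<Rightarrow> 'r) set" where
  "fin_funs A X = {f \<in> pts X \<rightarrow>\<^sub>E carrier A. supp A X f \<in> fins X}"

definition conv_index ::
  "('r, 's) ring_scheme \<Rightarrow> 'm fin_space \<Rightarrow> ('m \<times> 'm \<rightharpoonup> 'm) \<Rightarrow> 'm
     \<Rightarrow> ('m \<Rightarrow> 'r) \<Rightarrow> ('m \<Rightarrow> 'r) \<Rightarrow> ('m \<times> 'm) set" where
  "conv_index R M mu m f g = {(m1, m2) \<in> pts M \<times> pts M.
     mu (m1, m2) = Some m \<and> f m1 \<noteq> \<zero>\<^bsub>R\<^esub> \<and> g m2 \<noteq> \<zero>\<^bsub>R\<^esub>}"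

text \<open>The sum over \<open>conv_index\<close> is zero by convention if that index set is infinite, so finiteness
  of the index set has to be claimed separately.\<close>

definition fin_ring ::
  "('r, 's) ring_scheme \<Rightarrow> 'm fin_space \<Rightarrow> ('m \<times> 'm \<rightharpoonup> 'm) \<Rightarrow> (unit \<rightharpoonup> 'm) \<Rightarrow> ('m \<Rightarrow> 'r) ring"
  where
  "fin_ring R M mu eta =
     \<lparr>carrier = fin_funs R M,
      mult = (\<lambda>f g. \<lambda>m\<in>pts M.
        \<Oplus>\<^bsub>R\<^esub>p\<in>conv_index R M mu m f g. f (fst p) \<otimes>\<^bsub>R\<^esub> g (snd p)),
      one = (\<lambda>m\<in>pts M. if eta () = Some m then \<one>\<^bsub>R\<^esub> else \<zero>\<^bsub>R\<^esub>),
      zero = (\<lambda>m\<in>pts M. \<zero>\<^bsub>R\<^esub>),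
      add = (\<lambda>f g. \<lambda>m\<in>pts M. f m \<oplus>\<^bsub>R\<^esub> g m)\<rparr>"

end

theory Submission
  imports Defs
begin

text \<open>Condition (2) on \<open>\<mu>\<close>, applied to the singletons (which lie in every \<open>\<U>\<^sup>\<bottom>\<close>), makes the fibres
  of \<open>\<mu>\<close> over \<open>u \<times> v\<close> finite for finitary \<open>u\<close> and \<open>v\<close>; condition (1) bounds the support of a product
  by \<open>\<mu>(u \<times> v)\<close>. Convolutions are then finite sums that may be taken over any such fibre containing
  the index set, and both bracketings of a triple product expand to the same finite sum over the
  triples whose \<open>\<mu>\<close>-product is the given point.\<close>

section \<open>Iterated finite sums\<close>

text \<open>Reindexing along the bijection turns the sum over \<open>T\<close> into one over
  \<open>Sigma I A\<close>, which splits into disjoint slices, one for each \<open>i\<close>. Each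
  bracketing of a triple product becomes a single sum over triples in this way.\<close>

lemma (in abelian_monoid) finsum_Sigma_bij:
  assumes bij: "bij_betw (\<lambda>(i, x). h i x) (Sigma I A) T"
    and fin: "finite I" "\<And>i. i \<in> I \<Longrightarrow> finite (A i)"
    and F: "F \<in> T \<rightarrow> carrier G"
  shows "(\<Oplus>i\<in>I. \<Oplus>x\<in>A i. F (h i x)) = (\<Oplus>t\<in>T. F t)"
proof -
  let ?h = "\<lambda>(i, x). h i x"
  have T: "T = ?h ` Sigma I A" and inj: "inj_on ?h (Sigma I A)"
    using bij by (auto simp: bij_betw_def)
  have Fh: "F (h i x) \<in> carrier G" if "i \<in> I" "x \<in> A i" for i x
    using that F unfolding T by force
  have "(\<Oplus>t\<in>T. F t) = (\<Oplus>p\<in>Sigma I A. F (?h p))"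
    unfolding T using F T inj by (intro finsum_reindex) auto
  also have "Sigma I A = (\<Union>i\<in>I. Pair i ` A i)"
    by auto
  also have "(\<Oplus>p\<in>\<dots>. F (?h p)) = (\<Oplus>i\<in>I. \<Oplus>p\<in>Pair i ` A i. F (?h p))"
    using fin Fh by (intro add.finprod_UN_disjoint) (auto simp: pairwise_def disjnt_def)
  also have "\<dots> = (\<Oplus>i\<in>I. \<Oplus>x\<in>A i. F (h i x))"
  proof (rule finsum_cong')
    fix i assume i: "i \<in> I"
    have "(\<Oplus>p\<in>Pair i ` A i. F (?h p)) = (\<Oplus>x\<in>A i. F (?h (i, x)))"
      using Fh i by (intro finsum_reindex) (auto simp: inj_on_def)
    then show "(\<Oplus>p\<in>Pair i ` A i. F (?h p)) = (\<Oplus>x\<in>A i. F (h i x))" by simp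
  qed (use Fh in auto)
  finally show ?thesis by simp
qed

section \<open>Closure properties of finitary sets\<close>

lemma finiteness_space_subset_pts:
  "finiteness_space X \<Longrightarrow> u \<in> fins X \<Longrightarrow> u \<subseteq> pts X"
  by (auto simp: finiteness_space_def)

text \<open>The biorthogonal with its outer half unfolded: closure under subsets and unions then
  reduces to facts about finite intersections.\<close>

lemma finiteness_space_fins_iff:
  assumes "finiteness_space X"
  shows "u \<in> fins X \<longleftrightarrow> u \<subseteq> pts X \<and> (\<forall>u' \<in> perp (pts X) (fins X). finite (u \<inter> u'))"
proof -
  have "u \<in> fins X \<longleftrightarrow> u \<in> perp (pts X) (perp (pts X) (fins X))"
    using assms by (simp add: finiteness_space_def)
  \<comment> \<open>The instantiation lets only the outer \<open>perp\<close> unfold, so that the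
    inner one stays visible as the dual.\<close>
  then show ?thesis by (simp add: perp_def[of _ "perp _ _"])
qed

lemma finiteness_space_downward_closed:
  assumes "finiteness_space X" "u \<in> fins X" "w \<subseteq> u"
  shows "w \<in> fins X"
  using assms(2,3) unfolding finiteness_space_fins_iff[OF assms(1)]
  by (meson Int_mono finite_subset order_refl subset_trans)

lemma finiteness_space_Un:
  assumes "finiteness_space X" "u \<in> fins X" "w \<in> fins X"
  shows "u \<union> w \<in> fins X"
  using assms(2,3) unfolding finiteness_space_fins_iff[OF assms(1)]
  by (auto simp: Int_Un_distrib2)

lemma finiteness_space_finite:
  assumes "finiteness_space X" "u \<subseteq> pts X" "finite u"
  shows "u \<in> fins X"
  using assms(2,3) unfolding finiteness_space_fins_iff[OF assms(1)] by auto

lemma finite_in_perp: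
  "u \<subseteq> X \<Longrightarrow> finite u \<Longrightarrow> u \<in> perp X U"
  by (auto simp: perp_def)

text \<open>The rectangle is one of the generators, and every family of subsets is contained in its
  biorthogonal.\<close>

lemma tensor_rectangle:
  assumes "finiteness_space X" "finiteness_space Y" "u \<in> fins X" "v \<in> fins Y"
  shows "u \<times> v \<in> fins (fin_tensor X Y)"
proof -
  have "u \<times> v \<subseteq> pts X \<times> pts Y"
    using assms by (intro Sigma_mono finiteness_space_subset_pts)
  then show ?thesis
    using assms unfolding fin_tensor_def perp_def fin_space.simps
    \<comment> \<open>The two nested orthogonals intersect the same sets in opposite orders.\<close>
    by (subst Int_commute) blast
qed

section \<open>Pointwise form of the monoid axioms\<close>

locale convolution = ring R for R :: "('r, 's) ring_scheme" (structure) +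
  fixes M :: "'m fin_space" and mu :: "'m \<times> 'm \<rightharpoonup> 'm" and eta :: "unit \<rightharpoonup> 'm"
  assumes monoid: "partial_finiteness_monoid M mu eta"
begin

lemma space: "finiteness_space M"
  and mu_hom: "mu \<in> finpf_hom (fin_tensor M M) M"
  and eta_hom: "eta \<in> finpf_hom fin_unit M"
  using monoid by (auto simp: partial_finiteness_monoid_def)

lemma mu_pts: "mu (a, b) = Some m \<Longrightarrow> a \<in> pts M \<and> b \<in> pts M \<and> m \<in> pts M"
  using mu_hom by (auto simp: finpf_hom_def fin_tensor_def dest: domI ranI subsetD)

lemma eta_pts: "eta () = Some m \<Longrightarrow> m \<in> pts M"
  using eta_hom by (auto simp: finpf_hom_def dest: ranI subsetD)

text \<open>The associativity square is an equality of partial functions, so evaluating it compares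
  definedness as well as values; the existential form records both.\<close>

lemma mu_assoc:
  "(\<exists>p. mu (a, b) = Some p \<and> mu (p, c) = Some m) \<longleftrightarrow>
   (\<exists>r. mu (b, c) = Some r \<and> mu (a, r) = Some m)"
proof (cases "a \<in> pts M \<and> b \<in> pts M \<and> c \<in> pts M")
  case True
  have "(mu \<circ>\<^sub>m map_tensor mu (finpf_id M)) ((a, b), c)
      = ((mu \<circ>\<^sub>m map_tensor (finpf_id M) mu) \<circ>\<^sub>m finpf_assoc M M M) ((a, b), c)"
    using monoid by (simp add: partial_finiteness_monoid_def)
  then show ?thesis
    using True by (auto simp: map_comp_def map_tensor_def finpf_id_def finpf_assoc_def
        split: option.splits)
\<comment> \<open>If one of the points lies outside \<open>pts M\<close>, neither bracketing is
  defined.\<close>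
qed (auto dest: mu_pts)

text \<open>The left unit law at \<open>((), m)\<close> has a defined right-hand side, which forces
  \<open>eta\<close> to be defined. Over an empty \<open>M\<close> there is no such
  \<open>m\<close>, and \<open>eta\<close> is undefined.\<close>

lemma eta_defined: "m \<in> pts M \<Longrightarrow> \<exists>x. eta () = Some x"
proof -
  assume "m \<in> pts M"
  moreover have "(mu \<circ>\<^sub>m map_tensor eta (finpf_id M)) ((), m) = finpf_lunit M ((), m)"
    using monoid by (simp add: partial_finiteness_monoid_def)
  ultimately show ?thesis
    by (auto simp: map_comp_def map_tensor_def finpf_id_def finpf_lunit_def split: option.splits)
qed

lemma mu_eta_left:
  assumes "eta () = Some x" "m \<in> pts M" shows "mu (x, m) = Some m"
proof -
  have "(mu \<circ>\<^sub>m map_tensor eta (finpf_id M)) ((), m) = finpf_lunit M ((), m)"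
    using monoid by (simp add: partial_finiteness_monoid_def)
  then show ?thesis
    using assms by (auto simp: map_comp_def map_tensor_def finpf_id_def finpf_lunit_def)
qed

lemma mu_eta_right:
  assumes "eta () = Some x" "m \<in> pts M" shows "mu (m, x) = Some m"
proof -
  have "(mu \<circ>\<^sub>m map_tensor (finpf_id M) eta) (m, ()) = finpf_runit M (m, ())"
    using monoid by (simp add: partial_finiteness_monoid_def)
  then show ?thesis
    using assms by (auto simp: map_comp_def map_tensor_def finpf_id_def finpf_runit_def)
qed

section \<open>Fibres and products of finitary sets\<close>

text \<open>The bounds \<open>u\<close> and \<open>v\<close> are kept free instead of being fixed to
  supports, so that several convolutions can share one index set.\<close>

definition fibre :: "'m \<Rightarrow> 'm set \<Rightarrow> 'm set \<Rightarrow> ('m \<times> 'm) set" where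
  "fibre m u v = {(a, b) \<in> u \<times> v. mu (a, b) = Some m}"

text \<open>Written in the shape of the image in the first condition of
  \<open>finpf_hom\<close>.\<close>

definition set_mult :: "'m set \<Rightarrow> 'm set \<Rightarrow> 'm set" where
  "set_mult u v = {y. \<exists>p\<in>u \<times> v. mu p = Some y}"

text \<open>The preimage of the dual set \<open>{m}\<close> is dual to the tensor, hence meets the
  finitary rectangle \<open>u \<times> v\<close> in a finite set.\<close>

lemma finite_fibre:
  assumes "u \<in> fins M" "v \<in> fins M"
  shows "finite (fibre m u v)"
proof (cases "m \<in> pts M")
  case True
  let ?P = "{p \<in> pts (fin_tensor M M). \<exists>y\<in>{m}. mu p = Some y}"
  have "{m} \<in> perp (pts M) (fins M)"
    using True by (intro finite_in_perp) auto
  then have "?P \<in> perp (pts (fin_tensor M M)) (fins (fin_tensor M M))"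
    using mu_hom unfolding finpf_hom_def by blast
  then have "finite (?P \<inter> u \<times> v)"
    using tensor_rectangle[OF space space assms] by (auto simp: perp_def)
  moreover have "fibre m u v \<subseteq> ?P \<inter> u \<times> v"
    by (auto simp: fibre_def fin_tensor_def dest: mu_pts)
  ultimately show ?thesis by (rule finite_subset[rotated])
next
  case False
  then have "fibre m u v = {}" by (auto simp: fibre_def dest: mu_pts)
  then show ?thesis by simp
qed

lemma set_mult_fins:
  assumes "u \<in> fins M" "v \<in> fins M"
  shows "set_mult u v \<in> fins M"
  using mu_hom tensor_rectangle[OF space space assms] by (auto simp: finpf_hom_def set_mult_def)

section \<open>Convolution over enlarged index sets\<close>

abbreviation S where "S \<equiv> fin_ring R M mu eta"

lemma S_simps:
  "carrier S = fin_funs R M"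
  "\<zero>\<^bsub>S\<^esub> = (\<lambda>m\<in>pts M. \<zero>)"
  "\<one>\<^bsub>S\<^esub> = (\<lambda>m\<in>pts M. if eta () = Some m then \<one> else \<zero>)"
  "f \<oplus>\<^bsub>S\<^esub> g = (\<lambda>m\<in>pts M. f m \<oplus> g m)"
  by (simp_all add: fin_ring_def)

text \<open>Kept apart from \<open>S_simps\<close>, so that simplification with those equations
  leaves products folded for \<open>mult_apply\<close>.\<close>

lemma S_mult:
  "f \<otimes>\<^bsub>S\<^esub> g = (\<lambda>m\<in>pts M. \<Oplus>p\<in>conv_index R M mu m f g. f (fst p) \<otimes> g (snd p))"
  by (simp add: fin_ring_def)

lemma fin_funs_closed: "f \<in> fin_funs R M \<Longrightarrow> m \<in> pts M \<Longrightarrow> f m \<in> carrier R"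
  by (auto simp: fin_funs_def)

lemma fin_funs_supp: "f \<in> fin_funs R M \<Longrightarrow> supp R M f \<in> fins M"
  by (auto simp: fin_funs_def)

text \<open>Subsets of finitary sets are finitary, so a bound on the support is enough and supports
  need not be computed exactly.\<close>

lemma fin_funsI:
  assumes "f \<in> pts M \<rightarrow>\<^sub>E carrier R" "supp R M f \<subseteq> u" "u \<in> fins M"
  shows "f \<in> fin_funs R M"
  using assms finiteness_space_downward_closed[OF space] by (auto simp: fin_funs_def)

lemma fin_funs_eqI:
  assumes "f \<in> fin_funs R M" "g \<in> fin_funs R M" "\<And>m. m \<in> pts M \<Longrightarrow> f m = g m"
  shows "f = g"
  using assms by (auto simp: fin_funs_def intro: PiE_ext)

text \<open>Nonvanishing at a point of \<open>M\<close> is membership in the support; finiteness of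
  the index set thus becomes an instance of \<open>finite_fibre\<close>.\<close>

lemma conv_index_eq_fibre:
  "conv_index R M mu m f g = fibre m (supp R M f) (supp R M g)"
  by (auto simp: conv_index_def fibre_def supp_def)

text \<open>A pair of the larger fibre outside the index set has a vanishing factor and contributes
  zero, so the sum may run over any convenient finite fibre.\<close>

lemma mult_apply:
  assumes f: "f \<in> fin_funs R M" and g: "g \<in> fin_funs R M" and m: "m \<in> pts M"
    and u: "u \<in> fins M" "supp R M f \<subseteq> u" and v: "v \<in> fins M" "supp R M g \<subseteq> v"
  shows "(f \<otimes>\<^bsub>S\<^esub> g) m = (\<Oplus>p\<in>fibre m u v. f (fst p) \<otimes> g (snd p))"
proof -
  have pts: "a \<in> pts M \<and> b \<in> pts M" if "(a, b) \<in> fibre m u v" for a b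
    using that by (auto simp: fibre_def dest: mu_pts)
  have "(\<Oplus>p\<in>conv_index R M mu m f g. f (fst p) \<otimes> g (snd p))
      = (\<Oplus>p\<in>fibre m u v. f (fst p) \<otimes> g (snd p))"
  proof (rule add.finprod_mono_neutral_cong_left)
    show "finite (fibre m u v)" using u v by (intro finite_fibre)
    show "conv_index R M mu m f g \<subseteq> fibre m u v"
      unfolding conv_index_eq_fibre using u v by (auto simp: fibre_def)
    show "f (fst p) \<otimes> g (snd p) = \<zero>" if "p \<in> fibre m u v - conv_index R M mu m f g" for p
    proof -
      obtain a b where p: "p = (a, b)" by fastforce
      then have "a \<in> pts M" "b \<in> pts M" "f a = \<zero> \<or> g b = \<zero>"
        using that pts[of a b] by (auto simp: conv_index_def fibre_def)
      then show ?thesis using fin_funs_closed f g p by auto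
    qed
    show "(\<lambda>p. f (fst p) \<otimes> g (snd p)) \<in> fibre m u v \<rightarrow> carrier R"
      using pts fin_funs_closed f g by fastforce
  qed simp
  then show ?thesis using m by (simp add: S_mult)
qed

text \<open>A nonzero sum has a nonempty index set, and any index exhibits the point as a product of
  points of the two supports. Cancellation can make the inclusion strict.\<close>

lemma supp_mult: "supp R M (f \<otimes>\<^bsub>S\<^esub> g) \<subseteq> set_mult (supp R M f) (supp R M g)"
proof
  fix m assume m: "m \<in> supp R M (f \<otimes>\<^bsub>S\<^esub> g)"
  then have "conv_index R M mu m f g \<noteq> {}"
    by (auto simp: supp_def S_mult)
  then show "m \<in> set_mult (supp R M f) (supp R M g)"
    unfolding conv_index_eq_fibre by (auto simp: fibre_def set_mult_def)
qed

section \<open>Closure of the operations and the additive group\<close>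

lemma mult_closed:
  assumes "f \<in> fin_funs R M" "g \<in> fin_funs R M"
  shows "f \<otimes>\<^bsub>S\<^esub> g \<in> fin_funs R M"
proof (rule fin_funsI[OF _ supp_mult])
  show "f \<otimes>\<^bsub>S\<^esub> g \<in> pts M \<rightarrow>\<^sub>E carrier R"
    unfolding S_mult using assms
    by (auto intro!: finsum_closed simp: conv_index_def fin_funs_closed)
  show "set_mult (supp R M f) (supp R M g) \<in> fins M"
    using assms by (intro set_mult_fins fin_funs_supp)
qed

lemma add_closed:
  assumes "f \<in> fin_funs R M" "g \<in> fin_funs R M"
  shows "f \<oplus>\<^bsub>S\<^esub> g \<in> fin_funs R M"
proof (rule fin_funsI)
  show "supp R M (f \<oplus>\<^bsub>S\<^esub> g) \<subseteq> supp R M f \<union> supp R M g"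
    by (auto simp: supp_def S_simps)
  show "supp R M f \<union> supp R M g \<in> fins M"
    using assms by (intro finiteness_space_Un[OF space] fin_funs_supp)
qed (use assms in \<open>auto simp: S_simps fin_funs_closed\<close>)

lemma zero_closed': "\<zero>\<^bsub>S\<^esub> \<in> fin_funs R M"
  by (rule fin_funsI[of _ "{}"])
    (auto simp: S_simps supp_def intro: finiteness_space_finite[OF space])

lemma one_closed': "\<one>\<^bsub>S\<^esub> \<in> fin_funs R M"
proof (rule fin_funsI)
  show "supp R M \<one>\<^bsub>S\<^esub> \<subseteq> {m. eta () = Some m}"
    by (auto simp: S_simps supp_def split: if_splits)
  \<comment> \<open>This set is a singleton, or empty when \<open>eta\<close> is undefined; one
    bound covers both cases.\<close>
  have "finite {m. eta () = Some m}"
    by (cases "eta ()") auto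
  then show "{m. eta () = Some m} \<in> fins M"
    by (intro finiteness_space_finite[OF space]) (auto dest: eta_pts)
qed (auto simp: S_simps)

lemma uminus_closed:
  assumes "f \<in> fin_funs R M"
  shows "(\<lambda>m\<in>pts M. \<ominus> f m) \<in> fin_funs R M"
proof (rule fin_funsI)
  show "supp R M (\<lambda>m\<in>pts M. \<ominus> f m) \<subseteq> supp R M f"
    by (auto simp: supp_def)
qed (use assms in \<open>auto simp: fin_funs_closed fin_funs_supp\<close>)

lemma abelian_group_S: "abelian_group S"
proof (rule abelian_groupI)
  fix f assume f: "f \<in> carrier S"
  then have "(\<lambda>m\<in>pts M. \<ominus> f m) \<oplus>\<^bsub>S\<^esub> f = \<zero>\<^bsub>S\<^esub>"
    by (auto simp: S_simps fin_funs_closed l_neg)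
  then show "\<exists>g\<in>carrier S. g \<oplus>\<^bsub>S\<^esub> f = \<zero>\<^bsub>S\<^esub>"
    using f uminus_closed by (auto simp: S_simps(1))
  show "\<zero>\<^bsub>S\<^esub> \<oplus>\<^bsub>S\<^esub> f = f"
    using f by (intro fin_funs_eqI add_closed zero_closed') (auto simp: S_simps fin_funs_closed)
\<comment> \<open>Closure is settled while sums are still folded; unfolding them pointwise
  afterwards reduces associativity and commutativity to those of \<open>R\<close>.\<close>
qed (auto simp: S_simps(1) add_closed zero_closed', auto simp: S_simps fin_funs_closed a_ac)

section \<open>Associativity\<close>

lemma mult_assoc:
  assumes f: "f \<in> fin_funs R M" and g: "g \<in> fin_funs R M" and h: "h \<in> fin_funs R M"
  shows "(f \<otimes>\<^bsub>S\<^esub> g) \<otimes>\<^bsub>S\<^esub> h = f \<otimes>\<^bsub>S\<^esub> (g \<otimes>\<^bsub>S\<^esub> h)"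
proof (rule fin_funs_eqI)
  fix m assume m: "m \<in> pts M"
  define u v w where "u = supp R M f" and "v = supp R M g" and "w = supp R M h"
  have u: "u \<in> fins M" "supp R M f \<subseteq> u" and v: "v \<in> fins M" "supp R M g \<subseteq> v"
    and w: "w \<in> fins M" "supp R M h \<subseteq> w"
    using f g h by (auto simp: u_def v_def w_def fin_funs_supp)
  have uv: "set_mult u v \<in> fins M" "supp R M (f \<otimes>\<^bsub>S\<^esub> g) \<subseteq> set_mult u v"
    and vw: "set_mult v w \<in> fins M" "supp R M (g \<otimes>\<^bsub>S\<^esub> h) \<subseteq> set_mult v w"
    using set_mult_fins u v w supp_mult by (auto simp: u_def v_def w_def)
  \<comment> \<open>The triples with product \<open>m\<close>, described through the left
    bracketing; \<open>mu_assoc\<close> later supplies the right one.\<close>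
  define T where "T = {(a, b, c). a \<in> u \<and> b \<in> v \<and> c \<in> w \<and>
    (\<exists>p. mu (a, b) = Some p \<and> mu (p, c) = Some m)}"
  define F where "F = (\<lambda>(a, b, c). f a \<otimes> g b \<otimes> h c)"
  have pts: "a \<in> pts M" "b \<in> pts M" if "(a, b) \<in> fibre q x y" for a b q x y
    using that by (auto simp: fibre_def dest: mu_pts)
  have F: "F \<in> T \<rightarrow> carrier R"
    using f g h by (auto simp: F_def T_def fin_funs_closed dest!: mu_pts)
  \<comment> \<open>The outer sum uses \<open>set_mult u v\<close> and not the support of the inner
    product: cancellation may remove points from that support, and then triples of \<open>T\<close>
    would be missed.\<close>
  have "((f \<otimes>\<^bsub>S\<^esub> g) \<otimes>\<^bsub>S\<^esub> h) m
      = (\<Oplus>q\<in>fibre m (set_mult u v) w. (f \<otimes>\<^bsub>S\<^esub> g) (fst q) \<otimes> h (snd q))"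
    by (intro mult_apply mult_closed f g h m uv w)
  also have "\<dots> = (\<Oplus>q\<in>fibre m (set_mult u v) w. \<Oplus>r\<in>fibre (fst q) u v. F (fst r, snd r, snd q))"
  proof (rule finsum_cong'[OF refl])
    show "(\<lambda>q. \<Oplus>r\<in>fibre (fst q) u v. F (fst r, snd r, snd q))
        \<in> fibre m (set_mult u v) w \<rightarrow> carrier R"
      using f g h pts by (auto intro!: finsum_closed simp: F_def fin_funs_closed)
    fix q assume q: "q \<in> fibre m (set_mult u v) w"
    then have qp: "fst q \<in> pts M" "snd q \<in> pts M"
      using pts[of "fst q" "snd q"] by auto
    have "(f \<otimes>\<^bsub>S\<^esub> g) (fst q) \<otimes> h (snd q)
        = (\<Oplus>r\<in>fibre (fst q) u v. f (fst r) \<otimes> g (snd r)) \<otimes> h (snd q)"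
      by (simp add: mult_apply[OF f g qp(1) u v])
    also have "\<dots> = (\<Oplus>r\<in>fibre (fst q) u v. f (fst r) \<otimes> g (snd r) \<otimes> h (snd q))"
      using f g h qp pts by (intro finsum_ldistr finite_fibre u v) (auto simp: fin_funs_closed)
    finally show "(f \<otimes>\<^bsub>S\<^esub> g) (fst q) \<otimes> h (snd q)
        = (\<Oplus>r\<in>fibre (fst q) u v. F (fst r, snd r, snd q))"
      by (simp add: F_def)
  qed
  also have "\<dots> = (\<Oplus>t\<in>T. F t)"
  proof (rule finsum_Sigma_bij[OF _ _ _ F])
    show "bij_betw (\<lambda>(q, r). (fst r, snd r, snd q))
        (SIGMA q:fibre m (set_mult u v) w. fibre (fst q) u v) T"
      unfolding bij_betw_def
    proof
      \<comment> \<open>The forgotten component \<open>fst q\<close> is recovered as the value of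
        \<open>mu\<close> at \<open>r\<close>.\<close>
      show "inj_on (\<lambda>(q, r). (fst r, snd r, snd q))
          (SIGMA q:fibre m (set_mult u v) w. fibre (fst q) u v)"
        by (auto simp: inj_on_def fibre_def)
      show "(\<lambda>(q, r). (fst r, snd r, snd q)) `
          (SIGMA q:fibre m (set_mult u v) w. fibre (fst q) u v) = T"
        by (force simp: fibre_def T_def set_mult_def image_iff)
    qed
  qed (use u v w uv finite_fibre in auto)
  also have "\<dots> = (\<Oplus>q\<in>fibre m u (set_mult v w). \<Oplus>r\<in>fibre (snd q) v w. F (fst q, fst r, snd r))"
  proof (rule finsum_Sigma_bij[OF _ _ _ F, symmetric])
    show "bij_betw (\<lambda>(q, r). (fst q, fst r, snd r))
        (SIGMA q:fibre m u (set_mult v w). fibre (snd q) v w) T"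
      unfolding bij_betw_def
    proof
      show "inj_on (\<lambda>(q, r). (fst q, fst r, snd r))
          (SIGMA q:fibre m u (set_mult v w). fibre (snd q) v w)"
        by (auto simp: inj_on_def fibre_def)
      show "(\<lambda>(q, r). (fst q, fst r, snd r)) `
          (SIGMA q:fibre m u (set_mult v w). fibre (snd q) v w) = T"
        \<comment> \<open>Rebracketing the condition provides the intermediate product of the last
          two entries, which is the second component of \<open>q\<close>.\<close>
        unfolding T_def mu_assoc by (force simp: fibre_def set_mult_def image_iff)
    qed
  qed (use u v w vw finite_fibre in auto)
  also have "\<dots> = (\<Oplus>q\<in>fibre m u (set_mult v w). f (fst q) \<otimes> (g \<otimes>\<^bsub>S\<^esub> h) (snd q))"
  proof (rule finsum_cong'[OF refl])
    show "(\<lambda>q. f (fst q) \<otimes> (g \<otimes>\<^bsub>S\<^esub> h) (snd q)) \<in> fibre m u (set_mult v w) \<rightarrow> carrier R"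
      using f mult_closed[OF g h] pts by (auto simp: fin_funs_closed)
    fix q assume q: "q \<in> fibre m u (set_mult v w)"
    then have qp: "fst q \<in> pts M" "snd q \<in> pts M"
      using pts[of "fst q" "snd q"] by auto
    have "f (fst q) \<otimes> (g \<otimes>\<^bsub>S\<^esub> h) (snd q)
        = f (fst q) \<otimes> (\<Oplus>r\<in>fibre (snd q) v w. g (fst r) \<otimes> h (snd r))"
      by (simp add: mult_apply[OF g h qp(2) v w])
    also have "\<dots> = (\<Oplus>r\<in>fibre (snd q) v w. f (fst q) \<otimes> (g (fst r) \<otimes> h (snd r)))"
      using f g h qp pts by (intro finsum_rdistr finite_fibre v w) (auto simp: fin_funs_closed)
    also have "\<dots> = (\<Oplus>r\<in>fibre (snd q) v w. F (fst q, fst r, snd r))"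
      using f g h qp pts by (intro finsum_cong') (auto simp: F_def fin_funs_closed m_assoc)
    finally show "(\<Oplus>r\<in>fibre (snd q) v w. F (fst q, fst r, snd r))
        = f (fst q) \<otimes> (g \<otimes>\<^bsub>S\<^esub> h) (snd q)"
      by simp
  qed
  also have "\<dots> = (f \<otimes>\<^bsub>S\<^esub> (g \<otimes>\<^bsub>S\<^esub> h)) m"
    by (intro mult_apply[symmetric] mult_closed f g h m u vw)
  finally show "((f \<otimes>\<^bsub>S\<^esub> g) \<otimes>\<^bsub>S\<^esub> h) m = (f \<otimes>\<^bsub>S\<^esub> (g \<otimes>\<^bsub>S\<^esub> h)) m" .
qed (intro mult_closed f g h)+

section \<open>Unit laws\<close>

text \<open>The unit is a Kronecker delta at \<open>x\<close>. Only an inclusion holds, since in the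
  zero ring the support is empty.\<close>

lemma supp_one:
  assumes "eta () = Some x"
  shows "supp R M \<one>\<^bsub>S\<^esub> \<subseteq> {x}" "\<one>\<^bsub>S\<^esub> x = \<one>"
  using assms eta_pts[OF assms] by (auto simp: supp_def S_simps split: if_splits)

lemma singleton_fins: "m \<in> pts M \<Longrightarrow> {m} \<in> fins M"
  by (intro finiteness_space_finite[OF space]) auto

lemma one_mult:
  assumes f: "f \<in> fin_funs R M"
  shows "\<one>\<^bsub>S\<^esub> \<otimes>\<^bsub>S\<^esub> f = f"
proof (rule fin_funs_eqI)
  fix m assume m: "m \<in> pts M"
  obtain x where x: "eta () = Some x" using eta_defined[OF m] ..
  \<comment> \<open>Inserting \<open>m\<close> makes the fibre exactly \<open>{(x, m)}\<close> even
    if \<open>f m\<close> is zero, which avoids a case distinction.\<close>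
  define v where "v = insert m (supp R M f)"
  have v: "v \<in> fins M" "supp R M f \<subseteq> v"
    using finiteness_space_Un[OF space singleton_fins[OF m] fin_funs_supp[OF f]]
    by (auto simp: v_def)
  have fib: "fibre m {x} v = {(x, m)}"
    using mu_eta_left[OF x] m by (fastforce simp: fibre_def v_def supp_def)
  have "(\<one>\<^bsub>S\<^esub> \<otimes>\<^bsub>S\<^esub> f) m = (\<Oplus>p\<in>fibre m {x} v. \<one>\<^bsub>S\<^esub> (fst p) \<otimes> f (snd p))"
    by (intro mult_apply one_closed' f m v singleton_fins eta_pts[OF x] supp_one[OF x])
  then show "(\<one>\<^bsub>S\<^esub> \<otimes>\<^bsub>S\<^esub> f) m = f m"
    using fin_funs_closed[OF f m] by (simp add: fib supp_one[OF x])
qed (intro mult_closed one_closed' f)+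

text \<open>By the right unit law of \<open>mu\<close> the fibre over \<open>m\<close> collapses to
  \<open>(m, x)\<close>.\<close>

lemma mult_one:
  assumes f: "f \<in> fin_funs R M"
  shows "f \<otimes>\<^bsub>S\<^esub> \<one>\<^bsub>S\<^esub> = f"
proof (rule fin_funs_eqI)
  fix m assume m: "m \<in> pts M"
  obtain x where x: "eta () = Some x" using eta_defined[OF m] ..
  define u where "u = insert m (supp R M f)"
  have u: "u \<in> fins M" "supp R M f \<subseteq> u"
    using finiteness_space_Un[OF space singleton_fins[OF m] fin_funs_supp[OF f]]
    by (auto simp: u_def)
  have fib: "fibre m u {x} = {(m, x)}"
    using mu_eta_right[OF x] m by (fastforce simp: fibre_def u_def supp_def)
  have "(f \<otimes>\<^bsub>S\<^esub> \<one>\<^bsub>S\<^esub>) m = (\<Oplus>p\<in>fibre m u {x}. f (fst p) \<otimes> \<one>\<^bsub>S\<^esub> (snd p))"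
    by (intro mult_apply one_closed' f m u singleton_fins eta_pts[OF x] supp_one[OF x])
  then show "(f \<otimes>\<^bsub>S\<^esub> \<one>\<^bsub>S\<^esub>) m = f m"
    using fin_funs_closed[OF f m] by (simp add: fib supp_one[OF x])
qed (intro mult_closed one_closed' f)+

section \<open>Distributivity\<close>

text \<open>The supports of \<open>f\<close>, \<open>g\<close> and their sum differ, so all three
  convolutions are taken over one fibre, bounded by the union of the first two supports; there
  distributivity in \<open>R\<close> applies term by term.\<close>

lemma distrib_right:
  assumes f: "f \<in> fin_funs R M" and g: "g \<in> fin_funs R M" and h: "h \<in> fin_funs R M"
  shows "(f \<oplus>\<^bsub>S\<^esub> g) \<otimes>\<^bsub>S\<^esub> h = f \<otimes>\<^bsub>S\<^esub> h \<oplus>\<^bsub>S\<^esub> g \<otimes>\<^bsub>S\<^esub> h"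
proof (rule fin_funs_eqI)
  fix m assume m: "m \<in> pts M"
  define u v where "u = supp R M f \<union> supp R M g" and "v = supp R M h"
  have u: "u \<in> fins M" and v: "v \<in> fins M"
    using f g h by (auto simp: u_def v_def fin_funs_supp intro: finiteness_space_Un[OF space])
  have supp: "supp R M f \<subseteq> u" "supp R M g \<subseteq> u" "supp R M (f \<oplus>\<^bsub>S\<^esub> g) \<subseteq> u" "supp R M h \<subseteq> v"
    by (auto simp: u_def v_def supp_def S_simps)
  have pts: "a \<in> pts M" "b \<in> pts M" if "(a, b) \<in> fibre m u v" for a b
    using that by (auto simp: fibre_def dest: mu_pts)
  have "((f \<oplus>\<^bsub>S\<^esub> g) \<otimes>\<^bsub>S\<^esub> h) m = (\<Oplus>p\<in>fibre m u v. (f \<oplus>\<^bsub>S\<^esub> g) (fst p) \<otimes> h (snd p))"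
    by (intro mult_apply add_closed f g h m u v supp)
  also have "\<dots> = (\<Oplus>p\<in>fibre m u v. f (fst p) \<otimes> h (snd p) \<oplus> g (fst p) \<otimes> h (snd p))"
    using f g h pts by (intro finsum_cong') (auto simp: S_simps fin_funs_closed l_distr)
  also have "\<dots> = (\<Oplus>p\<in>fibre m u v. f (fst p) \<otimes> h (snd p))
      \<oplus> (\<Oplus>p\<in>fibre m u v. g (fst p) \<otimes> h (snd p))"
    using f g h pts by (intro finsum_addf) (auto simp: fin_funs_closed)
  also have "\<dots> = (f \<otimes>\<^bsub>S\<^esub> h \<oplus>\<^bsub>S\<^esub> g \<otimes>\<^bsub>S\<^esub> h) m"
    using m by (simp add: S_simps(4) mult_apply[OF f h m u supp(1) v supp(4)]
        mult_apply[OF g h m u supp(2) v supp(4)])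
  finally show "((f \<oplus>\<^bsub>S\<^esub> g) \<otimes>\<^bsub>S\<^esub> h) m = (f \<otimes>\<^bsub>S\<^esub> h \<oplus>\<^bsub>S\<^esub> g \<otimes>\<^bsub>S\<^esub> h) m" .
qed (intro mult_closed add_closed f g h)+

text \<open>Neither \<open>R\<close> nor \<open>mu\<close> is assumed commutative, so the mirrored
  law needs its own argument, with the bound on the right factor enlarged.\<close>

lemma distrib_left:
  assumes f: "f \<in> fin_funs R M" and g: "g \<in> fin_funs R M" and h: "h \<in> fin_funs R M"
  shows "h \<otimes>\<^bsub>S\<^esub> (f \<oplus>\<^bsub>S\<^esub> g) = h \<otimes>\<^bsub>S\<^esub> f \<oplus>\<^bsub>S\<^esub> h \<otimes>\<^bsub>S\<^esub> g"
proof (rule fin_funs_eqI)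
  fix m assume m: "m \<in> pts M"
  define u v where "u = supp R M h" and "v = supp R M f \<union> supp R M g"
  have u: "u \<in> fins M" and v: "v \<in> fins M"
    using f g h by (auto simp: u_def v_def fin_funs_supp intro: finiteness_space_Un[OF space])
  have supp: "supp R M f \<subseteq> v" "supp R M g \<subseteq> v" "supp R M (f \<oplus>\<^bsub>S\<^esub> g) \<subseteq> v" "supp R M h \<subseteq> u"
    by (auto simp: u_def v_def supp_def S_simps)
  have pts: "a \<in> pts M" "b \<in> pts M" if "(a, b) \<in> fibre m u v" for a b
    using that by (auto simp: fibre_def dest: mu_pts)
  have "(h \<otimes>\<^bsub>S\<^esub> (f \<oplus>\<^bsub>S\<^esub> g)) m = (\<Oplus>p\<in>fibre m u v. h (fst p) \<otimes> (f \<oplus>\<^bsub>S\<^esub> g) (snd p))"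
    by (intro mult_apply add_closed f g h m u v supp)
  also have "\<dots> = (\<Oplus>p\<in>fibre m u v. h (fst p) \<otimes> f (snd p) \<oplus> h (fst p) \<otimes> g (snd p))"
    using f g h pts by (intro finsum_cong') (auto simp: S_simps fin_funs_closed r_distr)
  also have "\<dots> = (\<Oplus>p\<in>fibre m u v. h (fst p) \<otimes> f (snd p))
      \<oplus> (\<Oplus>p\<in>fibre m u v. h (fst p) \<otimes> g (snd p))"
    using f g h pts by (intro finsum_addf) (auto simp: fin_funs_closed)
  also have "\<dots> = (h \<otimes>\<^bsub>S\<^esub> f \<oplus>\<^bsub>S\<^esub> h \<otimes>\<^bsub>S\<^esub> g) m"
    using m by (simp add: S_simps(4) mult_apply[OF h f m u supp(4) v supp(1)]
        mult_apply[OF h g m u supp(4) v supp(2)])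
  finally show "(h \<otimes>\<^bsub>S\<^esub> (f \<oplus>\<^bsub>S\<^esub> g)) m = (h \<otimes>\<^bsub>S\<^esub> f \<oplus>\<^bsub>S\<^esub> h \<otimes>\<^bsub>S\<^esub> g) m" .
qed (intro mult_closed add_closed f g h)+

section \<open>The ring axioms\<close>

lemma monoid_S: "Group.monoid S"
  by (rule monoidI)
    (simp_all add: S_simps(1) mult_closed one_closed' mult_assoc one_mult mult_one)

lemma ring_S: "ring S"
  by (rule ringI[OF abelian_group_S monoid_S])
    (simp_all add: S_simps(1) distrib_right distrib_left)

end

theorem theorem5:
  fixes R :: "('r, 's) ring_scheme"
    and M :: "'m fin_space"
    and mu :: "'m \<times> 'm \<rightharpoonup> 'm"
    and eta :: "unit \<rightharpoonup> 'm"
  assumes "partial_finiteness_monoid M mu eta"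
    and "ring R"
  shows "(\<forall>f \<in> fin_funs R M. \<forall>g \<in> fin_funs R M. \<forall>m \<in> pts M.
            finite (conv_index R M mu m f g))
         \<and> ring (fin_ring R M mu eta)"
proof -
  interpret convolution R M mu eta
    using assms by (simp add: convolution_def convolution_axioms_def)
  show ?thesis
    \<comment> \<open>Supports are finitary, so the index sets are finite fibres; the sums in the
      product are therefore never the default zero of an infinite sum.\<close>
    by (simp add: conv_index_eq_fibre finite_fibre fin_funs_supp ring_S)
qed

end
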